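(* $\xi_{\rm alg}(K_{d^2})=2$ for all integers $d\ge2$, where $K_{d^2}$ is the complete graph on $d^2$ vertices.
   Context: Let $G$ be a finite simple graph with vertex set $X$; write $x\sim y$ if $\{x,y\}$ is an edge. For a finite set $A$, $\mathfrak{B}(\varphi_G^A)$ is the universal unital complex *-algebra generated by matrix unit systems $(e_{x,a,a'})_{a,a'\in A}$, $x\in X$ (that is, $e_{x,a,b}e_{x,c,d}=\delta_{b,c}e_{x,a,d}$, $e_{x,a,b}^*=e_{x,b,a}$, $\sum_{a\in A}e_{x,a,a}=1$), subject to the relations $\sum_{a,b\in A}e_{x,a,b}e_{y,b,a}=0$ whenever $x\sim y$; equivalently, it is the quotient of the algebraic free product, amalgamated over the units, of $|X|$ copies of the matrix algebra $M_A$ by the *-ideal generated by these elements. It may be $\{0\}$. The algebraic orthogonal rank $\xi_{\rm alg}(G)$ is the smallest cardinality of a (non-empty) finite set $A$ for which $\mathfrak{B}(\varphi_G^A)\neq\{0\}$; if no such $A$ exists, $\xi_{\rm alg}(G)=\infty$. *)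

theory Defs
  imports
    "Graph_Theory.Kuratowski"
    "HOL-Library.Poly_Mapping"
    "HOL-Library.Extended_Nat"
    "HOL-Algebra.QuotRing"
    "HOL-Algebra.Module"
begin

section \<open>Unital complex *-algebras and their quotients\<close>

record 'a star_algebra = "(complex, 'a) module" +
  adj :: "'a \<Rightarrow> 'a"

locale star_algebra = ring A for A :: "('a, 'z) star_algebra_scheme" (structure) +
  assumes smult_closed [simp, intro]: "x \<in> carrier A \<Longrightarrow> c \<odot> x \<in> carrier A"
    and smult_l_distr: "x \<in> carrier A \<Longrightarrow> (c + d) \<odot> x = c \<odot> x \<oplus> d \<odot> x"
    and smult_r_distr: "\<lbrakk>x \<in> carrier A; y \<in> carrier A\<rbrakk> \<Longrightarrow> c \<odot> (x \<oplus> y) = c \<odot> x \<oplus> c \<odot> y"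
    and smult_assoc1: "x \<in> carrier A \<Longrightarrow> (c * d) \<odot> x = c \<odot> (d \<odot> x)"
    and smult_one [simp]: "x \<in> carrier A \<Longrightarrow> 1 \<odot> x = x"
    and smult_mult_l: "\<lbrakk>x \<in> carrier A; y \<in> carrier A\<rbrakk> \<Longrightarrow> (c \<odot> x) \<otimes> y = c \<odot> (x \<otimes> y)"
    and smult_mult_r: "\<lbrakk>x \<in> carrier A; y \<in> carrier A\<rbrakk> \<Longrightarrow> x \<otimes> (c \<odot> y) = c \<odot> (x \<otimes> y)"
    and adj_closed [simp, intro]: "x \<in> carrier A \<Longrightarrow> adj A x \<in> carrier A"
    and adj_adj [simp]: "x \<in> carrier A \<Longrightarrow> adj A (adj A x) = x"
    and adj_add: "\<lbrakk>x \<in> carrier A; y \<in> carrier A\<rbrakk> \<Longrightarrow> adj A (x \<oplus> y) = adj A x \<oplus> adj A y"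
    and adj_smult: "x \<in> carrier A \<Longrightarrow> adj A (c \<odot> x) = cnj c \<odot> adj A x"
    and adj_mult: "\<lbrakk>x \<in> carrier A; y \<in> carrier A\<rbrakk> \<Longrightarrow> adj A (x \<otimes> y) = adj A y \<otimes> adj A x"

text \<open>In a unital algebra a two-sided ring ideal is automatically a complex subspace, since it
  absorbs multiplication by \<open>c \<odot> \<one>\<close>; hence no separate closure under scalars is imposed.\<close>

definition star_ideal :: "'a set \<Rightarrow> ('a, 'z) star_algebra_scheme \<Rightarrow> bool" where
  "star_ideal I A \<longleftrightarrow> ideal I A \<and> (\<forall>x\<in>I. adj A x \<in> I)"

definition gen_star_ideal :: "('a, 'z) star_algebra_scheme \<Rightarrow> 'a set \<Rightarrow> 'a set" where
  "gen_star_ideal A S = \<Inter>{I. star_ideal I A \<and> S \<subseteq> I}"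

definition star_Quot :: "('a, 'z) star_algebra_scheme \<Rightarrow> 'a set \<Rightarrow> 'a set star_algebra" where
  "star_Quot A I = ring.extend (A Quot I)
     \<lparr>smult = (\<lambda>c K. \<Union>k\<in>K. I +>\<^bsub>A\<^esub> (c \<odot>\<^bsub>A\<^esub> k)),
      adj = (\<lambda>K. \<Union>k\<in>K. I +>\<^bsub>A\<^esub> adj A k)\<rparr>"

lemma star_Quot_simps [simp]:
  "carrier (star_Quot A I) = carrier (A Quot I)"
  "x \<otimes>\<^bsub>star_Quot A I\<^esub> y = x \<otimes>\<^bsub>A Quot I\<^esub> y"
  "\<one>\<^bsub>star_Quot A I\<^esub> = \<one>\<^bsub>A Quot I\<^esub>"
  "\<zero>\<^bsub>star_Quot A I\<^esub> = \<zero>\<^bsub>A Quot I\<^esub>"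
  "x \<oplus>\<^bsub>star_Quot A I\<^esub> y = x \<oplus>\<^bsub>A Quot I\<^esub> y"
  "c \<odot>\<^bsub>star_Quot A I\<^esub> K = (\<Union>k\<in>K. I +>\<^bsub>A\<^esub> (c \<odot>\<^bsub>A\<^esub> k))"
  "adj (star_Quot A I) K = (\<Union>k\<in>K. I +>\<^bsub>A\<^esub> adj A k)"
  by (simp_all add: star_Quot_def ring.defs)

lemma star_ideal_gen_star_ideal:
  assumes "star_algebra A" and "S \<subseteq> carrier A"
  shows "star_ideal (gen_star_ideal A S) A"
proof -
  interpret star_algebra A by fact
  have "star_ideal (carrier A) A"
    by (simp add: star_ideal_def oneideal)
  then have ne: "{I. star_ideal I A \<and> S \<subseteq> I} \<noteq> {}"
    using assms(2) by blast
  have "ideal (\<Inter>{I. star_ideal I A \<and> S \<subseteq> I}) A"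
    by (rule i_Intersect) (use ne in \<open>auto simp: star_ideal_def\<close>)
  then show ?thesis
    by (auto simp: star_ideal_def gen_star_ideal_def)
qed

lemma star_algebra_star_Quot:
  assumes "star_algebra A" and "star_ideal I A"
  shows "star_algebra (star_Quot A I)"
proof -
  interpret A: star_algebra A by fact
  interpret I: ideal I A using assms(2) by (simp add: star_ideal_def)
  have adjI: "adj A x \<in> I" if "x \<in> I" for x
    using that assms(2) by (simp add: star_ideal_def)
  have smultI: "c \<odot>\<^bsub>A\<^esub> x \<in> I" if "x \<in> I" for x c
  proof -
    have "c \<odot>\<^bsub>A\<^esub> x = (c \<odot>\<^bsub>A\<^esub> \<one>\<^bsub>A\<^esub>) \<otimes>\<^bsub>A\<^esub> x"
      using that I.a_subset by (subst A.smult_mult_l) auto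
    also have "\<dots> \<in> I" using that by (intro I.I_l_closed) auto
    finally show ?thesis .
  qed
  have coset: "\<exists>h\<in>I. k = h \<oplus>\<^bsub>A\<^esub> x" if "k \<in> I +>\<^bsub>A\<^esub> x" for k x
    using that by (auto simp: a_r_coset_def r_coset_def)
  have coset_eq: "I +>\<^bsub>A\<^esub> (h \<oplus>\<^bsub>A\<^esub> x) = I +>\<^bsub>A\<^esub> x" if "h \<in> I" "x \<in> carrier A" for h x
    using that I.a_subset by (metis A.a_coset_add_assoc I.a_Hcarr I.a_rcos_const)
  have adjQ: "adj (star_Quot A I) (I +>\<^bsub>A\<^esub> x) = I +>\<^bsub>A\<^esub> adj A x" if x: "x \<in> carrier A" for x
  proof -
    have "I +>\<^bsub>A\<^esub> adj A k = I +>\<^bsub>A\<^esub> adj A x" if k: "k \<in> I +>\<^bsub>A\<^esub> x" for k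
    proof -
      obtain h where h: "h \<in> I" "k = h \<oplus>\<^bsub>A\<^esub> x" using coset[OF k] by blast
      then have "h \<in> carrier A" using I.a_Hcarr by blast
      with h x show ?thesis
        by (simp only: A.adj_add) (rule coset_eq, simp_all only: adjI A.adj_closed)
    qed
    moreover have "x \<in> I +>\<^bsub>A\<^esub> x" using x by (rule I.a_rcos_self)
    ultimately show ?thesis unfolding star_Quot_simps by (intro SUP_eq_const) blast+
  qed
  have smultQ: "c \<odot>\<^bsub>star_Quot A I\<^esub> (I +>\<^bsub>A\<^esub> x) = I +>\<^bsub>A\<^esub> (c \<odot>\<^bsub>A\<^esub> x)" if x: "x \<in> carrier A" for x c
  proof -
    have "I +>\<^bsub>A\<^esub> (c \<odot>\<^bsub>A\<^esub> k) = I +>\<^bsub>A\<^esub> (c \<odot>\<^bsub>A\<^esub> x)" if k: "k \<in> I +>\<^bsub>A\<^esub> x" for k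
    proof -
      obtain h where h: "h \<in> I" "k = h \<oplus>\<^bsub>A\<^esub> x" using coset[OF k] by blast
      then have "h \<in> carrier A" using I.a_Hcarr by blast
      with h x show ?thesis
        by (simp only: A.smult_r_distr) (rule coset_eq, simp_all only: smultI A.smult_closed)
    qed
    moreover have "x \<in> I +>\<^bsub>A\<^esub> x" using x by (rule I.a_rcos_self)
    ultimately show ?thesis unfolding star_Quot_simps by (intro SUP_eq_const) blast+
  qed
  have ex: "\<exists>x\<in>carrier A. K = I +>\<^bsub>A\<^esub> x" if "K \<in> carrier (A Quot I)" for K
    using that by (auto simp: FactRing_def A_RCOSETS_def')
  have inc: "I +>\<^bsub>A\<^esub> x \<in> carrier (A Quot I)" if "x \<in> carrier A" for x
    using that by (auto simp: FactRing_def A_RCOSETS_def')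
  have mulQ: "(I +>\<^bsub>A\<^esub> x) \<otimes>\<^bsub>A Quot I\<^esub> (I +>\<^bsub>A\<^esub> y) = I +>\<^bsub>A\<^esub> (x \<otimes>\<^bsub>A\<^esub> y)"
    if "x \<in> carrier A" "y \<in> carrier A" for x y
    using that by (simp add: FactRing_def I.rcoset_mult_add)
  have addQ: "(I +>\<^bsub>A\<^esub> x) \<oplus>\<^bsub>A Quot I\<^esub> (I +>\<^bsub>A\<^esub> y) = I +>\<^bsub>A\<^esub> (x \<oplus>\<^bsub>A\<^esub> y)"
    if "x \<in> carrier A" "y \<in> carrier A" for x y
    using that by (simp add: FactRing_def I.a_rcos_sum)
  interpret Q: ring "A Quot I" by (rule I.quotient_is_ring)
  show ?thesis
  proof (rule star_algebra.intro)
    show "ring (star_Quot A I)"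
    proof (rule ringI)
      show "abelian_group (star_Quot A I)"
      proof (rule abelian_groupI)
        fix K assume "K \<in> carrier (star_Quot A I)"
        then show "\<exists>L\<in>carrier (star_Quot A I). L \<oplus>\<^bsub>star_Quot A I\<^esub> K = \<zero>\<^bsub>star_Quot A I\<^esub>"
          using Q.l_neg Q.a_inv_closed by auto
      qed (simp_all add: Q.a_ac)
      show "Group.monoid (star_Quot A I)"
        by (rule monoidI) (simp_all add: Q.m_assoc)
    qed (simp_all add: Q.l_distr Q.r_distr)
    show "star_algebra_axioms (star_Quot A I)"
      by (rule star_algebra_axioms.intro; simp only: star_Quot_simps(1-5))
         (auto dest!: ex simp del: star_Quot_simps(6,7)
            simp: adjQ smultQ mulQ addQ inc A.smult_l_distr A.smult_r_distr A.smult_assoc1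
              A.smult_mult_l A.smult_mult_r A.adj_add A.adj_smult A.adj_mult)
  qed
qed


section \<open>The free unital complex *-algebra on a set\<close>

text \<open>It is the monoid algebra over \<open>\<complex>\<close> of the free monoid on formal letters \<open>g\<close> and \<open>g*\<close>.
  \<^typ>\<open>_ \<Rightarrow>\<^sub>0 _\<close> multiplies by convolution along the additive monoid of its index type, so
  concatenation of words is written additively.\<close>

datatype 'g letter = Gen (base: 'g) | Adj (base: 'g)

primrec flip :: "'g letter \<Rightarrow> 'g letter" where
  "flip (Gen g) = Adj g"
| "flip (Adj g) = Gen g"

datatype 'g word = Word (letters: "'g letter list")

instantiation word :: (type) monoid_add
begin

definition "0 = Word []"
definition "v + w = Word (letters v @ letters w)"

instance
  by standard (simp_all add: zero_word_def plus_word_def)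

end

definition word_adj :: "'g word \<Rightarrow> 'g word" where
  "word_adj w = Word (map flip (rev (letters w)))"

lemma flip_flip [simp]: "flip (flip l) = l"
  by (cases l) simp_all

lemma base_flip [simp]: "base (flip l) = base l"
  by (cases l) simp_all

lemma word_adj_word_adj [simp]: "word_adj (word_adj w) = w"
  by (simp add: word_adj_def rev_map comp_def)

lemma word_adj_plus: "word_adj (v + w) = word_adj w + word_adj v"
  by (simp add: word_adj_def plus_word_def)

lemma word_adj_zero [simp]: "word_adj 0 = 0"
  by (simp add: word_adj_def zero_word_def)

lemma word_adj_eq_iff: "word_adj v = w \<longleftrightarrow> v = word_adj w"
  by auto

type_synonym 'g free_star = "'g word \<Rightarrow>\<^sub>0 complex"

lift_definition free_adj :: "'g free_star \<Rightarrow> 'g free_star" is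
  "\<lambda>f w. cnj (f (word_adj w))"
proof -
  fix f :: "'g word \<Rightarrow> complex"
  assume "finite {w. f w \<noteq> 0}"
  moreover have "inj word_adj" by (metis injI word_adj_word_adj)
  ultimately have "finite (word_adj -` {w. f w \<noteq> 0})" by (rule finite_vimageI)
  then show "finite {w. cnj (f (word_adj w)) \<noteq> 0}" by (simp add: vimage_def)
qed

definition gen :: "'g \<Rightarrow> 'g free_star" where
  "gen g = Poly_Mapping.single (Word [Gen g]) 1"

definition free_star_algebra :: "'g set \<Rightarrow> 'g free_star star_algebra" where
  "free_star_algebra X =
    \<lparr>carrier = {p. \<forall>w\<in>Poly_Mapping.keys p. base ` set (letters w) \<subseteq> X},
     mult = (*), one = 1, zero = 0, add = (+),
     smult = (\<lambda>c p. Poly_Mapping.single 0 c * p), adj = free_adj\<rparr>"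

lemma free_star_algebra_simps [simp]:
  "p \<in> carrier (free_star_algebra X) \<longleftrightarrow>
    (\<forall>w\<in>Poly_Mapping.keys p. base ` set (letters w) \<subseteq> X)"
  "p \<otimes>\<^bsub>free_star_algebra X\<^esub> q = p * q"
  "\<one>\<^bsub>free_star_algebra X\<^esub> = 1"
  "\<zero>\<^bsub>free_star_algebra X\<^esub> = 0"
  "p \<oplus>\<^bsub>free_star_algebra X\<^esub> q = p + q"
  "c \<odot>\<^bsub>free_star_algebra X\<^esub> p = Poly_Mapping.single 0 c * p"
  "adj (free_star_algebra X) = free_adj"
  by (simp_all add: free_star_algebra_def)

lemma free_adj_simps:
  "free_adj (p + q) = free_adj p + free_adj q"
  "free_adj 0 = 0"
  "free_adj (free_adj p) = p"
  "free_adj (Poly_Mapping.single w c) = Poly_Mapping.single (word_adj w) (cnj c)"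
     apply (transfer, simp)
    apply (transfer, simp)
   apply (transfer, simp)
  apply (transfer, auto simp: when_def fun_eq_iff word_adj_eq_iff)
  done

lemma keys_free_adj: "Poly_Mapping.keys (free_adj p) = word_adj ` Poly_Mapping.keys p"
  by (transfer, auto simp: image_iff) (metis word_adj_word_adj)

lemma poly_mapping_expand:
  "p = (\<Sum>k\<in>Poly_Mapping.keys p. Poly_Mapping.single k (Poly_Mapping.lookup p k))"
  by (rule poly_mapping_eqI)
     (auto simp: lookup_sum lookup_single when_def in_keys_iff)

lemma poly_mapping_add_induct:
  fixes p :: "'k \<Rightarrow>\<^sub>0 'b::comm_monoid_add"
  assumes "P 0" "\<And>k c. P (Poly_Mapping.single k c)" "\<And>p q. P p \<Longrightarrow> P q \<Longrightarrow> P (p + q)"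
  shows "P p"
proof -
  have "P (\<Sum>k\<in>K. Poly_Mapping.single k (Poly_Mapping.lookup p k))" for K
    by (induction K rule: infinite_finite_induct) (auto intro: assms)
  then show ?thesis by (metis poly_mapping_expand)
qed

lemma free_adj_mult: "free_adj (p * q) = free_adj q * free_adj p"
proof (induction p rule: poly_mapping_add_induct)
  case (2 k c)
  show ?case
    by (induction q rule: poly_mapping_add_induct)
       (simp_all add: free_adj_simps distrib_left distrib_right mult_single word_adj_plus mult.commute)
qed (simp_all add: free_adj_simps distrib_left distrib_right)

lemma single_zero_commute:
  fixes p :: "'g free_star"
  shows "p * Poly_Mapping.single 0 c = Poly_Mapping.single 0 c * p"
  by (induction p rule: poly_mapping_add_induct)
     (simp_all add: distrib_left distrib_right mult_single mult.commute)

lemma star_algebra_free: "star_algebra (free_star_algebra X)"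
proof -
  let ?F = "free_star_algebra X"
  have mult: "p * q \<in> carrier ?F" if "p \<in> carrier ?F" "q \<in> carrier ?F" for p q
    using that keys_mult[of p q] by (fastforce simp: plus_word_def)
  have add: "p + q \<in> carrier ?F" if "p \<in> carrier ?F" "q \<in> carrier ?F" for p q
    using that Poly_Mapping.keys_add[of p q] by fastforce
  have neg: "- p \<in> carrier ?F" if "p \<in> carrier ?F" for p
    using that by simp
  have const: "Poly_Mapping.single 0 c \<in> carrier ?F" for c
    by (simp add: zero_word_def)
  have one: "1 \<in> carrier ?F" using const[of 1] by simp
  have adj: "free_adj p \<in> carrier ?F" if "p \<in> carrier ?F" for p
    using that by (force simp: keys_free_adj word_adj_def)
  have "ring ?F"
  proof (rule ringI)
    show "abelian_group ?F"
    proof (rule abelian_groupI)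
      fix p assume "p \<in> carrier ?F"
      then show "\<exists>q\<in>carrier ?F. q \<oplus>\<^bsub>?F\<^esub> p = \<zero>\<^bsub>?F\<^esub>"
        by (intro bexI[of _ "- p"] neg) simp_all
    qed (use add in \<open>simp_all del: free_star_algebra_simps(1) add: add.assoc add.commute\<close>, simp)
    show "Group.monoid ?F"
      by (rule monoidI)
         (use mult one in \<open>simp_all del: free_star_algebra_simps(1) add: mult.assoc\<close>)
  qed (simp_all add: distrib_left distrib_right)
  moreover have "star_algebra_axioms ?F"
  proof (rule star_algebra_axioms.intro, unfold free_star_algebra_simps(2-))
    fix p q :: "'a free_star" and c d :: complex
    let ?s = "\<lambda>c :: complex. Poly_Mapping.single (0 :: 'a word) c"
    assume p: "p \<in> carrier ?F"
    show "?s c * p \<in> carrier ?F" "free_adj p \<in> carrier ?F"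
      by (intro mult const adj p)+
    show "?s (c + d) * p = ?s c * p + ?s d * p"
      by (simp add: single_add distrib_right)
    show "?s (c * d) * p = ?s c * (?s d * p)"
      by (simp add: mult_single mult.assoc[symmetric])
    show "?s 1 * p = p" "free_adj (free_adj p) = p"
      by (simp_all add: free_adj_simps)
    show "free_adj (?s c * p) = ?s (cnj c) * free_adj p"
      by (simp add: free_adj_mult free_adj_simps single_zero_commute)
    show "?s c * (p + q) = ?s c * p + ?s c * q"
      "free_adj (p + q) = free_adj p + free_adj q"
      by (simp_all add: distrib_left free_adj_simps)
    show "(?s c * p) * q = ?s c * (p * q)"
      by (rule mult.assoc)
    have "p * (?s c * q) = (p * ?s c) * q" by (rule mult.assoc[symmetric])
    also have "\<dots> = ?s c * (p * q)" by (simp only: single_zero_commute mult.assoc)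
    finally show "p * (?s c * q) = ?s c * (p * q)" .
    show "free_adj (p * q) = free_adj q * free_adj p"
      by (rule free_adj_mult)
  qed
  ultimately show ?thesis by (rule star_algebra.intro)
qed


section \<open>The algebraic orthogonal rank\<close>

text \<open>Finite simple graphs are the symmetric loop-free digraphs of the locale \<^locale>\<open>graph\<close>;
  adjacency \<open>x \<sim> y\<close> is \<open>x \<rightarrow>\<^bsub>G\<^esub> y\<close>. The generator \<open>e\<^bsub>x,a,b\<^esub>\<close> is indexed by the triple
  \<open>(x, a, b)\<close>, and a relation \<open>r = s\<close> is recorded as the element \<open>r - s\<close>.\<close>

abbreviation unit_gen :: "'v \<Rightarrow> 'a \<Rightarrow> 'a \<Rightarrow> ('v \<times> 'a \<times> 'a) free_star" where
  "unit_gen x a b \<equiv> gen (x, a, b)"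

definition unit_system_relations :: "'v set \<Rightarrow> 'a set \<Rightarrow> ('v \<times> 'a \<times> 'a) free_star set" where
  "unit_system_relations X A =
     {unit_gen x a b * unit_gen x c d - (if b = c then unit_gen x a d else 0) | x a b c d.
        x \<in> X \<and> a \<in> A \<and> b \<in> A \<and> c \<in> A \<and> d \<in> A} \<union>
     {free_adj (unit_gen x a b) - unit_gen x b a | x a b. x \<in> X \<and> a \<in> A \<and> b \<in> A} \<union>
     {(\<Sum>a\<in>A. unit_gen x a a) - 1 | x. x \<in> X}"

definition edge_relations ::
    "('v, 'arc) pre_digraph \<Rightarrow> 'a set \<Rightarrow> ('v \<times> 'a \<times> 'a) free_star set" where
  "edge_relations G A = {\<Sum>a\<in>A. \<Sum>b\<in>A. unit_gen x a b * unit_gen y b a | x y. x \<rightarrow>\<^bsub>G\<^esub> y}"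

definition orth_algebra ::
    "('v, 'arc) pre_digraph \<Rightarrow> 'a set \<Rightarrow> ('v \<times> 'a \<times> 'a) free_star set star_algebra" where
  "orth_algebra G A =
     (let F = free_star_algebra (verts G \<times> A \<times> A)
      in star_Quot F (gen_star_ideal F (unit_system_relations (verts G) A \<union> edge_relations G A)))"

text \<open>Up to isomorphism the algebra depends on \<open>A\<close> only through its cardinality, so finite sets of
  natural numbers suffice. The infimum of the empty set in \<^typ>\<open>enat\<close> is \<open>\<infinity>\<close>.\<close>

definition alg_orth_rank :: "('v, 'arc) pre_digraph \<Rightarrow> enat" where
  "alg_orth_rank G =
     Inf {enat (card A) | A :: nat set. finite A \<and> A \<noteq> {} \<and>
            carrier (orth_algebra G A) \<noteq> {\<zero>\<^bsub>orth_algebra G A\<^esub>}}"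

lemma star_algebra_orth_algebra:
  fixes G :: "('v, 'arc) pre_digraph" and A :: "'a set"
  assumes "wf_digraph G"
  shows "star_algebra (orth_algebra G A)"
proof -
  let ?F = "free_star_algebra (verts G \<times> A \<times> A)"
  interpret F: star_algebra ?F by (rule star_algebra_free)
  have gen: "unit_gen x a b \<in> carrier ?F" if "x \<in> verts G" "a \<in> A" "b \<in> A" for x a b
    using that by (simp add: gen_def)
  have add: "p + q \<in> carrier ?F" if "p \<in> carrier ?F" "q \<in> carrier ?F" for p q
    using F.a_closed[OF that] by simp
  have mult: "p * q \<in> carrier ?F" if "p \<in> carrier ?F" "q \<in> carrier ?F" for p q
    using F.m_closed[OF that] by simp
  have diff: "p - q \<in> carrier ?F" if "p \<in> carrier ?F" "q \<in> carrier ?F" for p q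
    using that keys_diff[of p q] by fastforce
  have adj: "free_adj p \<in> carrier ?F" if "p \<in> carrier ?F" for p
    using F.adj_closed[OF that] by simp
  have zero_one: "0 \<in> carrier ?F" "1 \<in> carrier ?F"
    using F.zero_closed F.one_closed by simp_all
  have sum: "sum f B \<in> carrier ?F" if "\<And>b. b \<in> B \<Longrightarrow> f b \<in> carrier ?F"
    for f and B :: "'a set"
    using that by (induction B rule: infinite_finite_induct)
      (simp_all del: free_star_algebra_simps(1) add: add zero_one)
  have "unit_system_relations (verts G) A \<subseteq> carrier ?F"
    unfolding unit_system_relations_def
    by (auto simp del: free_star_algebra_simps(1) intro!: diff mult adj sum gen zero_one)
  moreover have "edge_relations G A \<subseteq> carrier ?F"
    unfolding edge_relations_def
    using wf_digraph.adj_in_verts[OF assms]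
    by (auto simp del: free_star_algebra_simps(1) intro!: mult sum gen)
  ultimately show ?thesis
    unfolding orth_algebra_def Let_def
    by (intro star_algebra_star_Quot star_ideal_gen_star_ideal star_algebra_free) simp
qed

end

theory Submission
  imports Defs
begin

text \<open>A representation of the relations by plain linear operators suffices, since the elements
  annihilated together with their adjoints form a *-ideal when \<open>e\<^bsub>x,a,b\<^esub>*\<close> acts as \<open>e\<^bsub>x,b,a\<^esub>\<close>.
  Let \<open>q\<^sub>x\<close> and \<open>p\<^sub>x\<close> be operators with \<open>q\<^sub>x p\<^sub>x = 0\<close>, so that \<open>U\<^sub>x = [[1, q\<^sub>x], [p\<^sub>x, 1]]\<close> has
  the inverse \<open>[[1, -q\<^sub>x], [-p\<^sub>x, 1 + p\<^sub>x q\<^sub>x]]\<close>, and put \<open>e\<^bsub>x,a,b\<^esub> = U\<^sub>x E\<^bsub>a,b\<^esub> U\<^sub>x\<inverse>\<close>. The edge relation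
  for \<open>x \<noteq> y\<close> then reads \<open>q\<^sub>x p\<^sub>y = 2 + p\<^sub>x q\<^sub>x - p\<^sub>x q\<^sub>y\<close>. On functions of words over the vertices,
  with \<open>q\<^sub>x f = (\<lambda>w. f (x # w))\<close>, these equations are a definition of \<open>p\<^sub>y\<close> by recursion
  on the word. So matrix size two suffices for any loop-free graph, while size one forces
  \<open>1 = e\<^sub>x e\<^sub>y = 0\<close> as soon as there is an edge.\<close>

section \<open>Representations of the free *-algebra by linear operators\<close>

text \<open>Vectors are arbitrary complex functions on an index type. Source and target types may
  differ, so that \<open>col\<close> and \<open>row\<close>, which pass between single functions and
  pairs, are covered too.\<close>

definition linear_op :: "(('s \<Rightarrow> complex) \<Rightarrow> 't \<Rightarrow> complex) \<Rightarrow> bool" where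
  "linear_op T \<longleftrightarrow> (\<forall>c f g. T (\<lambda>s. c * f s + g s) = (\<lambda>t. c * T f t + T g t))"

lemma linear_opI:
  "(\<And>c f g t. T (\<lambda>s. c * f s + g s) t = c * T f t + T g t) \<Longrightarrow> linear_op T"
  by (auto simp: linear_op_def)

lemma linear_opD:
  "linear_op T \<Longrightarrow> T (\<lambda>s. c * f s + g s) = (\<lambda>t. c * T f t + T g t)"
  by (auto simp: linear_op_def)

lemma linear_op_comp: "linear_op S \<Longrightarrow> linear_op T \<Longrightarrow> linear_op (\<lambda>f. S (T f))"
  by (simp add: linear_op_def)

lemma linear_op_add:
  assumes "linear_op T" shows "T (\<lambda>s. f s + g s) = (\<lambda>t. T f t + T g t)"
  using linear_opD[OF assms, of 1 f g] by simp

lemma linear_op_zero: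
  assumes "linear_op T" shows "T (\<lambda>s. 0) = (\<lambda>t. 0)"
  using linear_opD[OF assms, of "-1" "\<lambda>s. 0" "\<lambda>s. 0"] by simp

lemma linear_op_scale:
  assumes "linear_op T" shows "T (\<lambda>s. c * f s) = (\<lambda>t. c * T f t)"
  using linear_opD[OF assms, of c f "\<lambda>s. 0"] linear_op_zero[OF assms] by simp

lemma linear_op_uminus:
  assumes "linear_op T" shows "T (\<lambda>s. - f s) = (\<lambda>t. - T f t)"
  using linear_op_scale[OF assms, of "-1" f] by simp

text \<open>Each letter, starred or not, receives its own operator, so no inner product is involved.
  The leftmost letter of a word acts last, which turns concatenation into composition.\<close>

definition eval_free ::
    "('g letter \<Rightarrow> ('t \<Rightarrow> complex) \<Rightarrow> 't \<Rightarrow> complex) \<Rightarrow> 'g free_star \<Rightarrow> ('t \<Rightarrow> complex) \<Rightarrow> 't \<Rightarrow> complex" where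
  "eval_free \<rho> p f t =
     (\<Sum>w\<in>Poly_Mapping.keys p. Poly_Mapping.lookup p w * foldr \<rho> (letters w) f t)"

text \<open>Lets polynomials with different supports be summed over one common index set.\<close>

lemma eval_free_superset:
  assumes "finite W" "Poly_Mapping.keys p \<subseteq> W"
  shows "eval_free \<rho> p f t = (\<Sum>w\<in>W. Poly_Mapping.lookup p w * foldr \<rho> (letters w) f t)"
  unfolding eval_free_def using assms by (intro sum.mono_neutral_left) (auto simp: in_keys_iff)

lemma eval_free_single:
  "eval_free \<rho> (Poly_Mapping.single w c) f t = c * foldr \<rho> (letters w) f t"
  by (subst eval_free_superset[of "{w}"]) auto

lemma eval_free_zero: "eval_free \<rho> 0 f t = 0"
  by (simp add: eval_free_def)

lemma eval_free_one: "eval_free \<rho> 1 f t = f t"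
  unfolding single_one[symmetric] eval_free_single by (simp add: zero_word_def)

lemma eval_free_add: "eval_free \<rho> (p + q) f t = eval_free \<rho> p f t + eval_free \<rho> q f t"
  using Poly_Mapping.keys_add[of p q]
  by (simp add: eval_free_superset[of "Poly_Mapping.keys p \<union> Poly_Mapping.keys q"]
      lookup_add distrib_right sum.distrib)

lemma eval_free_uminus: "eval_free \<rho> (- p) f t = - eval_free \<rho> p f t"
  by (simp add: eval_free_def sum_negf)

lemma eval_free_diff: "eval_free \<rho> (p - q) f t = eval_free \<rho> p f t - eval_free \<rho> q f t"
  using eval_free_add[of \<rho> p "- q"] by (simp add: eval_free_uminus)

lemma eval_free_sum: "eval_free \<rho> (\<Sum>i\<in>B. p i) f t = (\<Sum>i\<in>B. eval_free \<rho> (p i) f t)"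
  by (induction B rule: infinite_finite_induct) (simp_all add: eval_free_zero eval_free_add)

lemma eval_free_gen: "eval_free \<rho> (gen g) f = \<rho> (Gen g) f"
  by (rule ext) (simp add: gen_def eval_free_single)

lemma eval_free_adj_gen: "eval_free \<rho> (free_adj (gen g)) f = \<rho> (Adj g) f"
  by (rule ext) (simp add: gen_def free_adj_simps word_adj_def eval_free_single)

lemma linear_op_foldr:
  "(\<And>l. linear_op (\<rho> l)) \<Longrightarrow> linear_op (foldr \<rho> ls)"
  by (induction ls) (auto simp: linear_op_def)

lemma linear_op_eval_free:
  assumes "\<And>l. linear_op (\<rho> l)"
  shows "linear_op (eval_free \<rho> p)"
proof (rule linear_opI)
  fix c f g t
  show "eval_free \<rho> p (\<lambda>s. c * f s + g s) t = c * eval_free \<rho> p f t + eval_free \<rho> p g t"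
    by (simp add: eval_free_def linear_opD[OF linear_op_foldr[of \<rho>, OF assms]])
       (simp add: sum_distrib_left sum.distrib algebra_simps)
qed

text \<open>Both sides are additive in \<open>p\<close> and in \<open>q\<close>, which leaves
  monomials. There \<open>foldr\<close> over an append is a composition, and linearity moves the
  coefficient of \<open>q\<close> past the word of \<open>p\<close>.\<close>

lemma eval_free_mult:
  assumes "\<And>l. linear_op (\<rho> l)"
  shows "eval_free \<rho> (p * q) f = eval_free \<rho> p (eval_free \<rho> q f)"
proof (rule ext, induction p rule: poly_mapping_add_induct)
  case (2 v c)
  note lin = linear_op_foldr[of \<rho>, OF assms]
  show ?case for t
  proof (induction q arbitrary: t rule: poly_mapping_add_induct)
    case 1
    show ?case by (simp add: eval_free_zero eval_free_single linear_op_zero[OF lin])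
  next
    case (2 w d)
    show ?case
      by (simp add: mult_single eval_free_single plus_word_def linear_op_scale[OF lin])
  next
    case (3 q r)
    then show ?case
      by (simp add: distrib_left eval_free_add eval_free_single linear_op_add[OF lin])
  qed
qed (simp_all add: eval_free_zero eval_free_add distrib_right)

text \<open>The operators of a letter and of its star are unrelated a priori, so the vanishing of
  the adjoint is imposed separately.\<close>

definition eval_kernel ::
    "('g letter \<Rightarrow> ('t \<Rightarrow> complex) \<Rightarrow> 't \<Rightarrow> complex) \<Rightarrow> 'g set \<Rightarrow> 'g free_star set" where
  "eval_kernel \<rho> X = {p \<in> carrier (free_star_algebra X).
     \<forall>f. eval_free \<rho> p f = (\<lambda>t. 0) \<and> eval_free \<rho> (free_adj p) f = (\<lambda>t. 0)}"

text \<open>Since \<open>free_adj\<close> reverses products, multiplying on one side of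
  \<open>p\<close> multiplies its adjoint on the other side. In a composition with a zero operator,
  either position gives zero, because linear operators fix zero.\<close>

lemma star_ideal_eval_kernel:
  assumes "\<And>l. linear_op (\<rho> l)"
  shows "star_ideal (eval_kernel \<rho> X) (free_star_algebra X)"
proof -
  let ?F = "free_star_algebra X"
  let ?K = "eval_kernel \<rho> X"
  interpret F: star_algebra ?F by (rule star_algebra_free)
  note lin = linear_op_eval_free[of \<rho>, OF assms]
  have eval0: "eval_free \<rho> p (\<lambda>t. 0) = (\<lambda>t. 0)" for p
    by (rule linear_op_zero[OF lin])
  have inv: "\<ominus>\<^bsub>?F\<^esub> p = - p" if "p \<in> carrier ?F" for p
    using that by (intro F.minus_equality) (simp_all)
  have adj_uminus: "free_adj (- p) = - free_adj p" for p :: "'a free_star"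
    by transfer auto
  have "ideal ?K ?F"
  proof (rule idealI)
    show "ring ?F" by (rule F.ring_axioms)
    show "subgroup ?K (add_monoid ?F)"
    proof (rule F.add.subgroupI)
      show "?K \<subseteq> carrier ?F" by (auto simp: eval_kernel_def)
      have "0 \<in> ?K" by (simp add: eval_kernel_def eval_free_zero free_adj_simps fun_eq_iff)
      then show "?K \<noteq> {}" by blast
      show "\<ominus>\<^bsub>?F\<^esub> p \<in> ?K" if "p \<in> ?K" for p
        using that inv[of p] by (simp add: eval_kernel_def eval_free_uminus adj_uminus fun_eq_iff)
      show "p \<oplus>\<^bsub>?F\<^esub> q \<in> ?K" if "p \<in> ?K" "q \<in> ?K" for p q
        using that F.a_closed[of p q]
        by (auto simp: eval_kernel_def eval_free_add free_adj_simps fun_eq_iff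
            simp del: free_star_algebra_simps(1))
    qed
    fix p q assume "p \<in> ?K" "q \<in> carrier ?F"
    then show "q \<otimes>\<^bsub>?F\<^esub> p \<in> ?K" "p \<otimes>\<^bsub>?F\<^esub> q \<in> ?K"
      using F.m_closed[of p q] F.m_closed[of q p]
      by (auto simp: eval_kernel_def eval_free_mult[of \<rho>, OF assms] free_adj_mult eval0
          simp del: free_star_algebra_simps(1))
  qed
  moreover have "adj ?F p \<in> ?K" if "p \<in> ?K" for p
    using that F.adj_closed[of p]
    by (auto simp: eval_kernel_def free_adj_simps simp del: free_star_algebra_simps(1))
  ultimately show ?thesis by (simp add: star_ideal_def)
qed

section \<open>Matrix units on functions of words\<close>

text \<open>This is p_y. The second equation prescribes q_x p_y: for distinct \<open>x\<close> and
  \<open>y\<close> it is 2 + p_x q_x - p_x q_y, and for \<open>x = y\<close> the recursive argument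
  is the zero function, so that q_y p_y = 0. The value at \<open>[]\<close> is not constrained by
  these identities; 0 keeps the operator linear.\<close>

primrec raising :: "'v \<Rightarrow> ('v list \<Rightarrow> complex) \<Rightarrow> 'v list \<Rightarrow> complex" where
  "raising y f [] = 0"
| "raising y f (x # w) = (if x = y then 0 else 2 * f w) + raising x (\<lambda>v. f (x # v) - f (y # v)) w"

lemma linear_op_raising: "linear_op (raising y)"
proof (rule linear_opI)
  show "raising y (\<lambda>s. c * f s + g s) w = c * raising y f w + raising y g w" for c f g w
  proof (induction w arbitrary: y f g)
    case (Cons x w)
    have "(\<lambda>v. (c * f (x # v) + g (x # v)) - (c * f (y # v) + g (y # v))) =
        (\<lambda>v. c * (f (x # v) - f (y # v)) + (g (x # v) - g (y # v)))"
      by (simp add: algebra_simps)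
    then show ?case by (simp add: Cons.IH) (simp add: algebra_simps)
  qed simp
qed

lemmas raising_zero = linear_op_zero[OF linear_op_raising]

text \<open>The columns of \<open>U\<^sub>x\<close> and the rows of its inverse. A pair of functions is encoded as one
  function on \<open>bool \<times> 'v list\<close>, and the index \<open>0\<close> refers to the component \<open>False\<close>.\<close>

definition col :: "'v \<Rightarrow> nat \<Rightarrow> ('v list \<Rightarrow> complex) \<Rightarrow> bool \<times> 'v list \<Rightarrow> complex" where
  "col x a f = (\<lambda>(i, w).
     if a = 0 then (if i then raising x f w else f w) else (if i then f w else f (x # w)))"

text \<open>In the second row, -p_x and 1 + p_x q_x share the factor p_x, so a single call of
  \<open>raising\<close>, applied to the output of the first row, suffices.\<close>

definition row :: "'v \<Rightarrow> nat \<Rightarrow> (bool \<times> 'v list \<Rightarrow> complex) \<Rightarrow> 'v list \<Rightarrow> complex" where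
  "row x a f w =
     (if a = 0 then f (False, w) - f (True, x # w)
      else f (True, w) - raising x (\<lambda>v. f (False, v) - f (True, x # v)) w)"

lemma linear_op_col: "linear_op (col x a)"
  by (rule linear_opI) (auto simp: col_def linear_opD[OF linear_op_raising] split: prod.splits)

lemma linear_op_row: "linear_op (row x a)"
proof (rule linear_opI)
  fix c :: complex and f g :: "bool \<times> 'a list \<Rightarrow> complex" and w
  have "(\<lambda>v. (c * f (False, v) + g (False, v)) - (c * f (True, x # v) + g (True, x # v))) =
      (\<lambda>v. c * (f (False, v) - f (True, x # v)) + (g (False, v) - g (True, x # v)))"
    by (simp add: algebra_simps)
  then show "row x a (\<lambda>s. c * f s + g s) w = c * row x a f w + row x a g w"
    by (simp add: row_def linear_opD[OF linear_op_raising]) (simp add: algebra_simps)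
qed

text \<open>The inverse times U_x: every entry reduces to q_x p_x = 0 and p_x 0 = 0.\<close>

lemma row_col:
  assumes "a \<in> {0, 1}" "b \<in> {0, 1}"
  shows "row x b (col x a f) = (if a = b then f else (\<lambda>w. 0))"
  using assms by (auto simp: row_def col_def raising_zero fun_eq_iff)

text \<open>The product in the other order needs its own check, as the space is
  infinite-dimensional.\<close>

lemma sum_col_row: "(\<Sum>a\<in>{0, 1}. col x a (row x a f) t) = f t"
  by (cases t) (auto simp: row_def[abs_def] col_def raising_zero)

text \<open>The trace of the inverse of U_x times U_y is (1 - q_x p_y) + (1 + p_x q_x - p_x q_y),
  which the recursion for q_x p_y makes zero.\<close>

lemma sum_row_col:
  assumes "x \<noteq> y"
  shows "(\<Sum>b\<in>{0, 1}. row x b (col y b f) w) = 0"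
proof -
  \<comment> \<open>The two diagonal entries contribute p_x applied to opposite differences, which
    cancel.\<close>
  have "raising x (\<lambda>v. f (y # v) - f (x # v)) w = - raising x (\<lambda>v. f (x # v) - f (y # v)) w"
    using linear_op_uminus[OF linear_op_raising, of x "\<lambda>v. f (x # v) - f (y # v)"] by simp
  then show ?thesis using assms by (simp add: row_def col_def)
qed

section \<open>Conjugated matrix units and their relations\<close>

definition matrix_unit ::
    "'v \<Rightarrow> nat \<Rightarrow> nat \<Rightarrow> (bool \<times> 'v list \<Rightarrow> complex) \<Rightarrow> bool \<times> 'v list \<Rightarrow> complex" where
  "matrix_unit x a b f = col x a (row x b f)"

lemma linear_op_matrix_unit: "linear_op (matrix_unit x a b)"
  using linear_op_comp[OF linear_op_col linear_op_row, of x a x b]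
  by (simp add: matrix_unit_def[abs_def])

lemma matrix_unit_mult:
  assumes "b \<in> {0, 1}" "c \<in> {0, 1}"
  shows "matrix_unit x a b (matrix_unit x c d f) t = (if b = c then matrix_unit x a d f t else 0)"
  by (simp only: matrix_unit_def row_col[OF assms(2,1)])
     (simp add: linear_op_zero[OF linear_op_col])

lemma sum_matrix_unit_diag: "(\<Sum>a\<in>{0, 1}. matrix_unit x a a f t) = f t"
  by (simp only: matrix_unit_def sum_col_row)

text \<open>Summing over \<open>b\<close> first isolates the trace of \<open>sum_row_col\<close>
  between \<open>col x a\<close> and \<open>row y a\<close>, so already each term of the outer sum
  vanishes.\<close>

lemma sum_matrix_unit_edge:
  assumes "x \<noteq> y"
  shows "(\<Sum>a\<in>{0, 1}. \<Sum>b\<in>{0, 1}. matrix_unit x a b (matrix_unit y b a f) t) = 0"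
proof -
  have "(\<Sum>b\<in>{0, 1}. col x a (row x b (col y b g)) t) = 0" for a g
  proof -
    have "(\<Sum>b\<in>{0, 1}. col x a (row x b (col y b g)) t) =
        col x a (\<lambda>w. \<Sum>b\<in>{0, 1}. row x b (col y b g) w) t"
      by (simp add: linear_op_add[OF linear_op_col])
    then show ?thesis
      by (simp only: sum_row_col[OF assms] linear_op_zero[OF linear_op_col])
  qed
  then show ?thesis by (simp only: matrix_unit_def) simp
qed

primrec matrix_unit_rep ::
    "('v \<times> nat \<times> nat) letter \<Rightarrow> (bool \<times> 'v list \<Rightarrow> complex) \<Rightarrow> bool \<times> 'v list \<Rightarrow> complex" where
  "matrix_unit_rep (Gen g) = (case g of (x, a, b) \<Rightarrow> matrix_unit x a b)"
| "matrix_unit_rep (Adj g) = (case g of (x, a, b) \<Rightarrow> matrix_unit x b a)"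

lemma linear_op_matrix_unit_rep: "linear_op (matrix_unit_rep l)"
  by (cases l) (auto simp: linear_op_matrix_unit split: prod.splits)

section \<open>Triviality and non-triviality of the orthogonality algebra\<close>

text \<open>Reduces triviality of the algebra to whether 1 lies in the ideal of the
  relations.\<close>

lemma carrier_star_Quot_trivial_iff:
  assumes "star_algebra A" "star_ideal I A"
  shows "carrier (star_Quot A I) = {\<zero>\<^bsub>star_Quot A I\<^esub>} \<longleftrightarrow> \<one>\<^bsub>A\<^esub> \<in> I"
proof -
  interpret A: star_algebra A by fact
  interpret I: ideal I A using assms(2) by (simp add: star_ideal_def)
  have carr: "carrier (A Quot I) = (\<lambda>x. I +>\<^bsub>A\<^esub> x) ` carrier A"
    by (auto simp: FactRing_def A_RCOSETS_def')
  have zero: "\<zero>\<^bsub>A Quot I\<^esub> = I" by (simp add: FactRing_def)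
  show ?thesis
  proof
    assume "carrier (star_Quot A I) = {\<zero>\<^bsub>star_Quot A I\<^esub>}"
    then have "I +>\<^bsub>A\<^esub> \<one>\<^bsub>A\<^esub> = I" using carr zero by auto
    then show "\<one>\<^bsub>A\<^esub> \<in> I" using I.a_rcos_self[OF A.one_closed] by simp
  next
    assume "\<one>\<^bsub>A\<^esub> \<in> I"
    then have "I = carrier A" by (rule I.one_imp_carrier)
    then have "I +>\<^bsub>A\<^esub> x = I" if "x \<in> carrier A" for x
      using that by (intro I.a_rcos_const) simp
    then show "carrier (star_Quot A I) = {\<zero>\<^bsub>star_Quot A I\<^esub>}" using carr zero by auto
  qed
qed

abbreviation orth_relations ::
    "('v, 'arc) pre_digraph \<Rightarrow> 'a set \<Rightarrow> ('v \<times> 'a \<times> 'a) free_star set" where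
  "orth_relations G A \<equiv> unit_system_relations (verts G) A \<union> edge_relations G A"

lemma free_star_carrier_closed:
  shows gen_closed: "g \<in> X \<Longrightarrow> gen g \<in> carrier (free_star_algebra X)"
    and one_closed: "1 \<in> carrier (free_star_algebra X)"
    and zero_closed: "0 \<in> carrier (free_star_algebra X)"
    and mult_closed: "\<lbrakk>p \<in> carrier (free_star_algebra X); q \<in> carrier (free_star_algebra X)\<rbrakk>
      \<Longrightarrow> p * q \<in> carrier (free_star_algebra X)"
    and diff_closed: "\<lbrakk>p \<in> carrier (free_star_algebra X); q \<in> carrier (free_star_algebra X)\<rbrakk>
      \<Longrightarrow> p - q \<in> carrier (free_star_algebra X)"
    and free_adj_closed: "p \<in> carrier (free_star_algebra X) \<Longrightarrow> free_adj p \<in> carrier (free_star_algebra X)"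
proof -
  interpret F: star_algebra "free_star_algebra X" by (rule star_algebra_free)
  show "g \<in> X \<Longrightarrow> gen g \<in> carrier (free_star_algebra X)" by (simp add: gen_def)
  show "1 \<in> carrier (free_star_algebra X)" "0 \<in> carrier (free_star_algebra X)"
    using F.one_closed F.zero_closed by simp_all
  show "p * q \<in> carrier (free_star_algebra X)" "p - q \<in> carrier (free_star_algebra X)"
    if "p \<in> carrier (free_star_algebra X)" "q \<in> carrier (free_star_algebra X)"
    using that F.m_closed[of p q] keys_diff[of p q] by fastforce+
  show "free_adj p \<in> carrier (free_star_algebra X)" if "p \<in> carrier (free_star_algebra X)"
    using F.adj_closed[OF that] by simp
qed

lemma sum_closed:
  assumes "\<And>i. i \<in> B \<Longrightarrow> p i \<in> carrier (free_star_algebra X)"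
  shows "sum p B \<in> carrier (free_star_algebra X)"
proof -
  have "Poly_Mapping.keys (sum p B) \<subseteq> (\<Union>i\<in>B. Poly_Mapping.keys (p i))"
    by (rule keys_sum)
  then show ?thesis using assms by fastforce
qed

lemma orth_relations_closed:
  assumes "wf_digraph G"
  shows "orth_relations G A \<subseteq> carrier (free_star_algebra (verts G \<times> A \<times> A))"
  unfolding unit_system_relations_def edge_relations_def
  using wf_digraph.adj_in_verts[OF assms]
  by (auto simp del: free_star_algebra_simps(1) intro!: free_star_carrier_closed sum_closed)

lemma orth_algebra_trivial_iff:
  assumes "wf_digraph G"
  shows "carrier (orth_algebra G A) = {\<zero>\<^bsub>orth_algebra G A\<^esub>} \<longleftrightarrow>
    1 \<in> gen_star_ideal (free_star_algebra (verts G \<times> A \<times> A)) (orth_relations G A)"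
  unfolding orth_algebra_def Let_def
  using carrier_star_Quot_trivial_iff[OF star_algebra_free
      star_ideal_gen_star_ideal[OF star_algebra_free orth_relations_closed[OF assms]]]
  by (simp only: free_star_algebra_simps(3))

lemma orth_algebra_singleton_trivial:
  assumes "wf_digraph G" "x \<rightarrow>\<^bsub>G\<^esub> y"
  shows "carrier (orth_algebra G {a}) = {\<zero>\<^bsub>orth_algebra G {a}\<^esub>}"
proof -
  let ?F = "free_star_algebra (verts G \<times> {a} \<times> {a})"
  let ?I = "gen_star_ideal ?F (orth_relations G {a})"
  interpret wf_digraph G by fact
  interpret F: star_algebra ?F by (rule star_algebra_free)
  interpret I: ideal ?I ?F
    using star_ideal_gen_star_ideal[OF star_algebra_free orth_relations_closed[OF assms(1)], of "{a}"]
    unfolding star_ideal_def by (rule conjunct1)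
  have sub: "orth_relations G {a} \<subseteq> ?I" by (auto simp: gen_star_ideal_def)
  have xy: "x \<in> verts G" "y \<in> verts G" using adj_in_verts[OF assms(2)] by auto
  let ?u = "unit_gen x a a" and ?v = "unit_gen y a a"
  have u: "?u - 1 \<in> ?I" "?v - 1 \<in> ?I"
    using sub xy by (auto simp: unit_system_relations_def)
  have uv: "?u * ?v \<in> ?I"
    using sub assms(2) by (auto simp: edge_relations_def)
  have add: "p + q \<in> ?I" if "p \<in> ?I" "q \<in> ?I" for p q
    using I.a_closed[OF that] by simp
  have mult: "p * q \<in> ?I" if "p \<in> ?I" "q \<in> carrier ?F" for p q
    using I.I_r_closed[OF that] by simp
  have one: "- 1 \<in> carrier ?F" using diff_closed[OF zero_closed one_closed] by simp
  have v: "?v \<in> carrier ?F" using xy by (intro gen_closed) simp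
  have neg: "- p \<in> ?I" if "p \<in> ?I" for p
    using mult[OF that one] by simp
  \<comment> \<open>This combination of the edge relation and the two unit-sum relations expands to
    1.\<close>
  have "?u * ?v + - ((?u - 1) * ?v) + - (?v - 1) \<in> ?I"
    by (rule add[OF add[OF uv neg[OF mult[OF u(1) v]]] neg[OF u(2)]])
  then have "1 \<in> ?I" by (simp add: algebra_simps)
  then show ?thesis by (simp add: orth_algebra_trivial_iff[OF assms(1)])
qed

text \<open>All relations lie in the kernel of the representation, hence so does the *-ideal they
  generate, while 1 acts as the identity on a nonzero space.\<close>

lemma orth_algebra_two_nontrivial:
  assumes "wf_digraph G" and loopfree: "\<And>x y. x \<rightarrow>\<^bsub>G\<^esub> y \<Longrightarrow> x \<noteq> y"
  shows "carrier (orth_algebra G {0, 1::nat}) \<noteq> {\<zero>\<^bsub>orth_algebra G {0, 1}\<^esub>}"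
proof -
  let ?A = "{0, 1::nat}"
  let ?X = "verts G \<times> ?A \<times> ?A"
  let ?K = "eval_kernel matrix_unit_rep ?X"
  note eval_simps = eval_free_mult[of matrix_unit_rep, OF linear_op_matrix_unit_rep]
    eval_free_diff eval_free_gen eval_free_adj_gen eval_free_sum eval_free_one
    eval_free_zero
  have adj_diff: "free_adj (p - q) = free_adj p - free_adj q" for p q :: "'g free_star"
    by transfer auto
  have adj_one: "free_adj (1 :: 'g free_star) = 1"
    using free_adj_simps(4)[of "0 :: 'g word" 1] by simp
  have adj_sum: "free_adj (sum p B) = (\<Sum>i\<in>B. free_adj (p i))"
    for p :: "'i \<Rightarrow> 'g free_star" and B
    by (induction B rule: infinite_finite_induct) (simp_all add: free_adj_simps)
  note adj_simps = adj_diff adj_one adj_sum free_adj_mult free_adj_simps(2,3)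
  have carr: "r \<in> carrier (free_star_algebra ?X)" if "r \<in> orth_relations G ?A" for r
    using orth_relations_closed[OF assms(1)] that by blast
  have "r \<in> ?K" if "r \<in> orth_relations G ?A" for r
  proof -
    have "eval_free matrix_unit_rep r f t = 0 \<and> eval_free matrix_unit_rep (free_adj r) f t = 0" for f t
      using that
    proof (elim UnE)
      assume "r \<in> unit_system_relations (verts G) ?A"
      then show ?thesis
        unfolding unit_system_relations_def
      proof (elim UnE CollectE exE conjE)
        fix x a b c d
        assume r: "r = unit_gen x a b * unit_gen x c d - (if b = c then unit_gen x a d else 0)"
          and "a \<in> ?A" "b \<in> ?A" "c \<in> ?A" "d \<in> ?A"
        then show ?thesis
          unfolding r adj_simps eval_simps
          \<comment> \<open>The adjoint of the product acts as e_{x,d,c} e_{x,b,a}, whose inner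
            indices are compared in the order \<open>c\<close>, \<open>b\<close>; hence
            \<open>not_sym\<close>.\<close>
          by (cases "b = c")
             (simp_all only: if_True if_False refl not_sym simp_thms adj_simps eval_simps
               matrix_unit_rep.simps prod.case matrix_unit_mult, simp_all)
      next
        fix x a b
        assume r: "r = free_adj (unit_gen x a b) - unit_gen x b a"
        show ?thesis unfolding r adj_simps eval_simps by simp
      next
        fix x
        assume r: "r = (\<Sum>a\<in>?A. unit_gen x a a) - 1"
        show ?thesis
          unfolding r adj_simps eval_simps
          by (simp only: matrix_unit_rep.simps prod.case sum_matrix_unit_diag) simp
      qed
    next
      assume "r \<in> edge_relations G ?A"
      then obtain x y where xy: "x \<rightarrow>\<^bsub>G\<^esub> y"
        and r: "r = (\<Sum>a\<in>?A. \<Sum>b\<in>?A. unit_gen x a b * unit_gen y b a)"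
        unfolding edge_relations_def by blast
      have "x \<noteq> y" by (rule loopfree[OF xy])
      \<comment> \<open>The adjoint of an edge relation acts as the edge sum with \<open>x\<close>
        and \<open>y\<close> exchanged.\<close>
      then show ?thesis
        unfolding r adj_simps eval_simps
        by (simp only: matrix_unit_rep.simps prod.case sum_matrix_unit_edge not_sym simp_thms)
    qed
    then show ?thesis using carr[OF that] by (simp add: eval_kernel_def fun_eq_iff)
  qed
  then have "gen_star_ideal (free_star_algebra ?X) (orth_relations G ?A) \<subseteq> ?K"
    unfolding gen_star_ideal_def
    using star_ideal_eval_kernel[of matrix_unit_rep ?X, OF linear_op_matrix_unit_rep] by blast
  moreover have "1 \<notin> ?K"
    \<comment> \<open>The constant function 1 is a vector not annihilated by the identity.\<close>
    by (auto simp: eval_kernel_def eval_free_one fun_eq_iff intro!: exI[of _ "\<lambda>_. 1"])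
  ultimately show ?thesis
    using orth_algebra_trivial_iff[OF assms(1), of ?A] by blast
qed

section \<open>The rank of a loop-free graph with an edge\<close>

lemma alg_orth_rank_eq_2:
  assumes "wf_digraph G" "\<And>x y. x \<rightarrow>\<^bsub>G\<^esub> y \<Longrightarrow> x \<noteq> y" "x \<rightarrow>\<^bsub>G\<^esub> y"
  shows "alg_orth_rank G = 2"
  unfolding alg_orth_rank_def
proof (rule antisym[OF Inf_lower Inf_greatest])
  have "(2::enat) = enat (card {0, 1::nat})" by (simp add: numeral_eq_enat)
  moreover note orth_algebra_two_nontrivial[OF assms(1,2)]
  ultimately show "2 \<in> {enat (card A) | A :: nat set. finite A \<and> A \<noteq> {} \<and>
      carrier (orth_algebra G A) \<noteq> {\<zero>\<^bsub>orth_algebra G A\<^esub>}}"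
    by (intro CollectI exI[of _ "{0, 1::nat}"]) auto
next
  fix k
  assume "k \<in> {enat (card A) | A :: nat set. finite A \<and> A \<noteq> {} \<and>
      carrier (orth_algebra G A) \<noteq> {\<zero>\<^bsub>orth_algebra G A\<^esub>}}"
  then obtain A :: "nat set" where A: "k = enat (card A)" "finite A" "A \<noteq> {}"
    "carrier (orth_algebra G A) \<noteq> {\<zero>\<^bsub>orth_algebra G A\<^esub>}"
    by blast
  have "card A \<noteq> 1"
    using A(4) orth_algebra_singleton_trivial[OF assms(1,3)] by (metis card_1_singletonE)
  moreover have "card A \<noteq> 0" using A(2,3) by simp
  ultimately show "2 \<le> k" using A(1) by (simp add: numeral_eq_enat)
qed

theorem proposition5p17:
  fixes G :: "('v, 'arc) pre_digraph" and d :: nat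
  assumes "d \<ge> 2" and "complete_digraph (d\<^sup>2) G"
  shows "alg_orth_rank G = 2"
proof -
  interpret graph G using assms(2) by (simp add: complete_digraph_def)
  have card: "card (verts G) = d\<^sup>2"
    and arcs: "arcs_ends G = {(u, v). (u, v) \<in> verts G \<times> verts G \<and> u \<noteq> v}"
    using assms(2) by (auto simp: complete_digraph_def)
  \<comment> \<open>There are at least four vertices, and any two distinct ones supply an
    edge.\<close>
  have "2\<^sup>2 \<le> d\<^sup>2" using assms(1) by (rule power_mono) simp
  then have "\<not> card (verts G) \<le> Suc 0" using card by simp
  then obtain x y where "x \<in> verts G" "y \<in> verts G" "x \<noteq> y"
    using card_le_Suc0_iff_eq[OF finite_verts] by blast
  then have "x \<rightarrow>\<^bsub>G\<^esub> y" using arcs by simp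
  moreover have "u \<noteq> v" if "u \<rightarrow>\<^bsub>G\<^esub> v" for u v using that arcs by auto
  ultimately show ?thesis
    using alg_orth_rank_eq_2[OF wf_digraph_axioms] by blast
qed

end
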